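(* Let $n\ge 1$ and let $M\in\mathbb{R}^{n\times n}$. For every Givens rotation $G\in\mathbb{R}^{n\times n}$ supported on a mirror pair, \[ D(GM)+A(GM)=D(M)+A(M)\qquad\text{and}\qquad D(MG)+A(MG)=D(M)+A(M). \] That is, the functional $D+A$ is invariant under left- or right-multiplication of $M$ by any Givens rotation supported on a mirror pair.
   Context: For $M=(m_{ij})\in\mathbb{R}^{n\times n}$ put $D(M)=\sum_{i=1}^{n} m_{ii}^{2}$ and $A(M)=\sum_{i=1}^{n} m_{i,\,n+1-i}^{2}$ (the sums of squares on the main diagonal and on the anti-diagonal). For $a\in\{1,\dots,n\}$ put $a^{*}=n+1-a$. A mirror pair is a set $\{a,a^{*}\}$ with $a\ne a^{*}$. A Givens rotation supported on $\{a,a^{*}\}$ is an $n\times n$ real matrix that equals the identity matrix outside rows and columns $a,a^{*}$, and whose $2\times 2$ block on rows and columns $a,a^{*}$ is $\begin{pmatrix} c & -s\\ s & c\end{pmatrix}$ with $c,s\in\mathbb{R}$ and $c^{2}+s^{2}=1$; i.e. $G_{aa}=G_{a^{*}a^{*}}=c$, $G_{aa^{*}}=-s$, $G_{a^{*}a}=s$. *)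

theory Defs
  imports Complex_Main "Jordan_Normal_Form.Matrix"
begin

text \<open>Rows and columns of an \<open>n \<times> n\<close> matrix are numbered \<open>0, \<dots>, n - 1\<close>, so the index
  \<open>a\<^sup>* = n + 1 - a\<close> of the numbering from \<open>1\<close> becomes \<open>n - 1 - a\<close>.\<close>

definition mirror :: "nat \<Rightarrow> nat \<Rightarrow> nat" where
  "mirror n a = n - 1 - a"

definition diag_sq :: "real mat \<Rightarrow> real" where
  "diag_sq M = (\<Sum>i<dim_row M. (M $$ (i, i))\<^sup>2)"

definition antidiag_sq :: "real mat \<Rightarrow> real" where
  "antidiag_sq M = (\<Sum>i<dim_row M. (M $$ (i, mirror (dim_row M) i))\<^sup>2)"

definition mirror_pair :: "nat \<Rightarrow> nat set \<Rightarrow> bool" where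
  "mirror_pair n P \<longleftrightarrow> (\<exists>a<n. a \<noteq> mirror n a \<and> P = {a, mirror n a})"

text \<open>Either element of \<open>P\<close> may play the role of \<open>a\<close>; exchanging them replaces \<open>s\<close> by \<open>-s\<close>.\<close>

definition givens_rotation :: "nat \<Rightarrow> nat set \<Rightarrow> real mat \<Rightarrow> bool" where
  "givens_rotation n P G \<longleftrightarrow>
     G \<in> carrier_mat n n \<and>
     (\<forall>i<n. \<forall>j<n. \<not> (i \<in> P \<and> j \<in> P) \<longrightarrow> G $$ (i, j) = 1\<^sub>m n $$ (i, j)) \<and>
     (\<exists>a b c s. P = {a, b} \<and> a \<noteq> b \<and> c\<^sup>2 + s\<^sup>2 = 1 \<and>
        G $$ (a, a) = c \<and> G $$ (b, b) = c \<and> G $$ (a, b) = - s \<and> G $$ (b, a) = s)"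

end

theory Submission imports Defs begin

text \<open>Multiplication by a Givens rotation on \<open>{a, a\<^sup>*}\<close> only changes entries in rows
  (or columns) \<open>a\<close> and \<open>a\<^sup>*\<close>. The entries of these rows counted by \<open>D + A\<close> are exactly the four
  entries at the positions \<open>{a, a\<^sup>*} \<times> {a, a\<^sup>*}\<close>, and this \<open>2 \<times> 2\<close> block is multiplied by a
  rotation, which preserves the sum of the squares of its entries.\<close>

lemma sum_lessThan_remove2:
  fixes f :: "nat \<Rightarrow> 'a::comm_monoid_add"
  assumes "a < n" "b < n" "a \<noteq> b"
  shows "(\<Sum>i<n. f i) = f a + f b + (\<Sum>i\<in>{..<n} - {a, b}. f i)"
proof -
  have "(\<Sum>i<n. f i) = (\<Sum>i\<in>{a, b}. f i) + (\<Sum>i\<in>{..<n} - {a, b}. f i)"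
    using assms by (subst sum.subset_diff[of "{a, b}"]) (auto simp: add.commute)
  then show ?thesis
    using assms by simp
qed

lemma mat_mult_entry:
  assumes "A \<in> carrier_mat n m" "B \<in> carrier_mat m p" "i < n" "j < p"
  shows "(A * B) $$ (i, j) = (\<Sum>k<m. A $$ (i, k) * B $$ (k, j))"
  using assms by (auto simp: scalar_prod_def lessThan_atLeast0 intro!: sum.cong)

text \<open>This is multiplicativity of the modulus in \<open>(c + i s) (x + i y)\<close>. It is
  applied to columns of the block for \<open>G * M\<close> and to rows of the block for
  \<open>M * G\<close>.\<close>

lemma rotation_sum_squares:
  fixes c s x y :: real
  assumes "c\<^sup>2 + s\<^sup>2 = 1"
  shows "(c * x - s * y)\<^sup>2 + (s * x + c * y)\<^sup>2 = x\<^sup>2 + y\<^sup>2"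
proof -
  have "(c * x - s * y)\<^sup>2 + (s * x + c * y)\<^sup>2 = (c\<^sup>2 + s\<^sup>2) * (x\<^sup>2 + y\<^sup>2)"
    by (simp add: power2_eq_square algebra_simps)
  then show ?thesis
    using assms by simp
qed

lemma diag_sq_plus_antidiag_sq:
  assumes "N \<in> carrier_mat n n"
  shows "diag_sq N + antidiag_sq N =
    (\<Sum>i<n. (N $$ (i, i))\<^sup>2 + (N $$ (i, mirror n i))\<^sup>2)"
  using assms by (auto simp: diag_sq_def antidiag_sq_def sum.distrib)

text \<open>An entry with exactly one index in the pair lies on neither diagonal, since the pair is
  closed under \<open>mirror n\<close>. So it suffices to compare the block and the entries with
  both indices outside; this serves both products alike.\<close>

lemma diag_antidiag_sq_eqI:
  assumes N: "N \<in> carrier_mat n n" and M: "M \<in> carrier_mat n n"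
    and a: "a < n" "a \<noteq> mirror n a"
    and outside: "\<And>i j. \<lbrakk>i < n; j < n; i \<notin> {a, mirror n a}; j \<notin> {a, mirror n a}\<rbrakk>
      \<Longrightarrow> N $$ (i, j) = M $$ (i, j)"
    and block: "(N $$ (a, a))\<^sup>2 + (N $$ (a, mirror n a))\<^sup>2
        + (N $$ (mirror n a, mirror n a))\<^sup>2 + (N $$ (mirror n a, a))\<^sup>2
      = (M $$ (a, a))\<^sup>2 + (M $$ (a, mirror n a))\<^sup>2
        + (M $$ (mirror n a, mirror n a))\<^sup>2 + (M $$ (mirror n a, a))\<^sup>2"
  shows "diag_sq N + antidiag_sq N = diag_sq M + antidiag_sq M"
proof -
  \<comment> \<open>For \<open>a < n\<close> the natural subtraction \<open>n - 1 - a\<close> is not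
    truncated, so \<open>mirror n\<close> is an involution there.\<close>
  have b: "mirror n a < n" "mirror n (mirror n a) = a"
    using a by (auto simp: mirror_def)
  have "(\<Sum>i\<in>{..<n} - {a, mirror n a}. (N $$ (i, i))\<^sup>2 + (N $$ (i, mirror n i))\<^sup>2)
      = (\<Sum>i\<in>{..<n} - {a, mirror n a}. (M $$ (i, i))\<^sup>2 + (M $$ (i, mirror n i))\<^sup>2)"
  proof (rule sum.cong)
    fix i assume i: "i \<in> {..<n} - {a, mirror n a}"
    \<comment> \<open>An involution that maps the pair to itself also maps its complement to
      itself.\<close>
    then have "mirror n i < n" "mirror n i \<notin> {a, mirror n a}"
      using a by (auto simp: mirror_def)
    with i show "(N $$ (i, i))\<^sup>2 + (N $$ (i, mirror n i))\<^sup>2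
        = (M $$ (i, i))\<^sup>2 + (M $$ (i, mirror n i))\<^sup>2"
      by (simp add: outside)
  qed simp
  then show ?thesis
    using block
    by (simp add: diag_sq_plus_antidiag_sq[OF N] diag_sq_plus_antidiag_sq[OF M]
        sum_lessThan_remove2[OF a(1) b(1) a(2)] b(2))
qed

text \<open>The definition leaves open which element of \<open>P\<close> carries \<open>- s\<close>
  in its row. Here that element is called \<open>a\<close>, and the other one is identified as its
  mirror image.\<close>

lemma givens_rotation_mirror_pairE:
  assumes "mirror_pair n P" "givens_rotation n P G"
  obtains a c s where "a < n" "a \<noteq> mirror n a" "c\<^sup>2 + s\<^sup>2 = 1" "G \<in> carrier_mat n n"
    "G $$ (a, a) = c" "G $$ (mirror n a, mirror n a) = c"
    "G $$ (a, mirror n a) = - s" "G $$ (mirror n a, a) = s"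
    "\<And>i j. \<lbrakk>i < n; j < n; i \<notin> {a, mirror n a} \<or> j \<notin> {a, mirror n a}\<rbrakk>
      \<Longrightarrow> G $$ (i, j) = (if i = j then 1 else 0)"
proof -
  from assms(1) obtain a' where a': "a' < n" "a' \<noteq> mirror n a'" "P = {a', mirror n a'}"
    by (auto simp: mirror_pair_def)
  from assms(2) obtain a b c s where G: "G \<in> carrier_mat n n"
    and P: "P = {a, b}" "a \<noteq> b" and cs: "c\<^sup>2 + s\<^sup>2 = 1"
    and block: "G $$ (a, a) = c" "G $$ (b, b) = c" "G $$ (a, b) = - s" "G $$ (b, a) = s"
    and outside: "\<And>i j. \<lbrakk>i < n; j < n; i \<notin> P \<or> j \<notin> P\<rbrakk> \<Longrightarrow> G $$ (i, j) = 1\<^sub>m n $$ (i, j)"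
    unfolding givens_rotation_def by blast
  have "mirror n (mirror n a') = a'" "mirror n a' < n"
    using a'(1) by (auto simp: mirror_def)
  \<comment> \<open>Either \<open>a = a'\<close>, or \<open>a\<close> is the mirror image of
    \<open>a'\<close>; in the second case the involution gives
    \<open>b = a' = mirror n a\<close>.\<close>
  then have a: "a < n" "b = mirror n a"
    using a' P by (auto simp: doubleton_eq_iff)
  show thesis
    using that[of a c s] a P G cs block outside by simp
qed

theorem theorem3p1:
  fixes n :: nat and M G :: "real mat" and P :: "nat set"
  assumes "n \<ge> 1"
    and "M \<in> carrier_mat n n"
    and "mirror_pair n P"
    and "givens_rotation n P G"
  shows "diag_sq (G * M) + antidiag_sq (G * M) = diag_sq M + antidiag_sq M
    \<and> diag_sq (M * G) + antidiag_sq (M * G) = diag_sq M + antidiag_sq M"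
proof -
  from assms(3,4) obtain a c s where a: "a < n" "a \<noteq> mirror n a" and cs: "c\<^sup>2 + s\<^sup>2 = 1"
    and G: "G \<in> carrier_mat n n"
    and block: "G $$ (a, a) = c" "G $$ (mirror n a, mirror n a) = c"
      "G $$ (a, mirror n a) = - s" "G $$ (mirror n a, a) = s"
    and outside: "\<And>i j. \<lbrakk>i < n; j < n; i \<notin> {a, mirror n a} \<or> j \<notin> {a, mirror n a}\<rbrakk>
      \<Longrightarrow> G $$ (i, j) = (if i = j then 1 else 0)"
    by (rule givens_rotation_mirror_pairE) blast
  define b where "b = mirror n a"
  note a = a[folded b_def] and block = block[folded b_def] and outside = outside[folded b_def]
  have b: "b < n"
    using a by (auto simp: b_def mirror_def)
  note M = assms(2)
  have GM: "G * M \<in> carrier_mat n n" and MG: "M * G \<in> carrier_mat n n"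
    using G M by auto
  \<comment> \<open>In a row of the pair, \<open>G\<close> vanishes off the columns \<open>a\<close>
    and \<open>b\<close>, so two terms of the product remain.\<close>
  have left: "(G * M) $$ (i, j) = G $$ (i, a) * M $$ (a, j) + G $$ (i, b) * M $$ (b, j)"
    if "i \<in> {a, b}" "j < n" for i j
  proof -
    have "i < n"
      using that a b by auto
    moreover have "(\<Sum>k\<in>{..<n} - {a, b}. G $$ (i, k) * M $$ (k, j)) = 0"
      using that \<open>i < n\<close> by (intro sum.neutral) (auto simp: outside)
    ultimately show ?thesis
      using that by (simp add: mat_mult_entry[OF G M] sum_lessThan_remove2[OF a(1) b a(2)])
  qed
  have right: "(M * G) $$ (i, j) = M $$ (i, a) * G $$ (a, j) + M $$ (i, b) * G $$ (b, j)"
    if "j \<in> {a, b}" "i < n" for i j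
  proof -
    have "j < n"
      using that a b by auto
    moreover have "(\<Sum>k\<in>{..<n} - {a, b}. M $$ (i, k) * G $$ (k, j)) = 0"
      using that \<open>j < n\<close> by (intro sum.neutral) (auto simp: outside)
    ultimately show ?thesis
      using that by (simp add: mat_mult_entry[OF M G] sum_lessThan_remove2[OF a(1) b a(2)])
  qed
  have "diag_sq (G * M) + antidiag_sq (G * M) = diag_sq M + antidiag_sq M"
  proof (rule diag_antidiag_sq_eqI[OF GM M, of a], fold b_def)
    fix i j assume ij: "i < n" "j < n" "i \<notin> {a, b}" "j \<notin> {a, b}"
    \<comment> \<open>Row \<open>i\<close> of \<open>G\<close> is a row of the identity
      matrix.\<close>
    have "(G * M) $$ (i, j) = (\<Sum>k<n. if i = k then M $$ (k, j) else 0)"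
      unfolding mat_mult_entry[OF G M ij(1,2)]
      using ij by (intro sum.cong) (auto simp: outside)
    then show "(G * M) $$ (i, j) = M $$ (i, j)"
      using ij by simp
  next
    show "((G * M) $$ (a, a))\<^sup>2 + ((G * M) $$ (a, b))\<^sup>2
        + ((G * M) $$ (b, b))\<^sup>2 + ((G * M) $$ (b, a))\<^sup>2
      = (M $$ (a, a))\<^sup>2 + (M $$ (a, b))\<^sup>2 + (M $$ (b, b))\<^sup>2 + (M $$ (b, a))\<^sup>2"
      \<comment> \<open>The block of \<open>G\<close> rotates each column
        \<open>(M $$ (a, j), M $$ (b, j))\<close> for \<open>j = a\<close> and
        \<open>j = b\<close>.\<close>
      using rotation_sum_squares[OF cs, of "M $$ (a, a)" "M $$ (b, a)"]
        rotation_sum_squares[OF cs, of "M $$ (a, b)" "M $$ (b, b)"] a b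
      by (simp add: left block)
  qed (use a in auto)
  moreover have "diag_sq (M * G) + antidiag_sq (M * G) = diag_sq M + antidiag_sq M"
  proof (rule diag_antidiag_sq_eqI[OF MG M, of a], fold b_def)
    fix i j assume ij: "i < n" "j < n" "i \<notin> {a, b}" "j \<notin> {a, b}"
    have "(M * G) $$ (i, j) = (\<Sum>k<n. if j = k then M $$ (i, k) else 0)"
      unfolding mat_mult_entry[OF M G ij(1,2)]
      using ij by (intro sum.cong) (auto simp: outside)
    then show "(M * G) $$ (i, j) = M $$ (i, j)"
      using ij by simp
  next
    show "((M * G) $$ (a, a))\<^sup>2 + ((M * G) $$ (a, b))\<^sup>2
        + ((M * G) $$ (b, b))\<^sup>2 + ((M * G) $$ (b, a))\<^sup>2
      = (M $$ (a, a))\<^sup>2 + (M $$ (a, b))\<^sup>2 + (M $$ (b, b))\<^sup>2 + (M $$ (b, a))\<^sup>2"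
      \<comment> \<open>On the right the block acts on rows by its transpose, so the arguments are
        swapped: with \<open>x = M $$ (i, b)\<close> and \<open>y = M $$ (i, a)\<close>, the entry
        in column \<open>b\<close> is \<open>c * x - s * y\<close> and the one in column
        \<open>a\<close> is \<open>s * x + c * y\<close>.\<close>
      using rotation_sum_squares[OF cs, of "M $$ (a, b)" "M $$ (a, a)"]
        rotation_sum_squares[OF cs, of "M $$ (b, b)" "M $$ (b, a)"] a b
      by (simp add: right block algebra_simps)
  qed (use a in auto)
  ultimately show ?thesis ..
qed

end
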